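(* The three-stage two-parameter EERK3-2 method (explicit exponential Runge-Kutta method, defined in the context) with $c_2=1$ and $c_3=\frac12$, where $g_h$ is Lipschitz continuous with constant $\ell_g>0$ and $\kappa\ge2\ell_g$, preserves the energy dissipation law $\frac{\mathrm{d}E}{\mathrm{d}t}=-\big\langle\frac{\mathrm{d}u_h}{\mathrm{d}t},\frac{\mathrm{d}u_h}{\mathrm{d}t}\big\rangle\le0$ at all stages in the sense that $$E[U^{n,j+1}]-E[U^{n,1}]\le-\frac1\tau\sum_{k=1}^{j}\Big\langle\delta_\tau U^{n,k+1},\sum_{\ell=1}^{k}d^{(3,2)}_{k\ell}(1,\tfrac12,-\tau L_\kappa)\,\delta_\tau U^{n,\ell+1}\Big\rangle\qquad\text{for }1\le j\le3,$$ where $\delta_\tau U^{n,k+1}:=U^{n,k+1}-U^{n,k}$ and $D^{(3,2)}(c_2,c_3,z)=(d^{(3,2)}_{k\ell}(c_2,c_3,z))$ is the differentiation matrix of the method.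
   Context: $\tau>0$ is the time step and $n\ge1$. $\langle u,v\rangle=v^Tu$ and $\|v\|=\sqrt{\langle v,v\rangle}$ on $\mathbb{R}^M$; Lipschitz is with respect to $\|\cdot\|$. $L_h\in\mathbb{R}^{M\times M}$ is symmetric positive definite. $G_h\ge0$ is a non-negative Lyapunov function with $g_h(v)=-\frac{\delta}{\delta v}G_h(v)$, i.e. the gradient of the scalar function $v\mapsto\langle G_h(v),1\rangle$ is $-g_h(v)$, where $1$ is the all-ones vector. The energy is $E[v]=\frac12\langle v,L_hv\rangle+\langle G_h(v),1\rangle$, and the gradient system is $u_h'=-L_hu_h+g_h(u_h)$. Stabilized operators: $L_\kappa:=L_h+\kappa I$, $g_\kappa(u):=g_h(u)+\kappa u$. $\varphi_0(z)=e^z$, $\varphi_{k+1}(z)=(\varphi_k(z)-1/k!)/z$ (entire functions, extended continuously to $z=0$). For a function $f$, $f(-\tau L_\kappa)$ is the matrix function defined through the spectrum of the symmetric matrix $-\tau L_\kappa$. EERK3-2 method (abscissas $c_2\ne\frac23$, $c_3\ne c_2$, $c_3\neq\frac23$; $\gamma:=\frac{(3c_3-2)c_3}{(2-3c_2)c_2}$): $U^{n,1}=u_h^{n-1}$, $U^{n,i+1}=U^{n,1}+\sum_{j=1}^{i}a_{i+1,j}(-\tau L_\kappa)[\tau g_\kappa(U^{n,j})-\tau L_\kappa U^{n,1}]$ for $1\le i\le3$, $u_h^n=U^{n,4}$, with $a_{21}(z)=c_2\varphi_1(c_2z)$; $a_{32}(z)=\gamma c_2\varphi_2(c_2z)+\frac{c_3^2}{c_2}\varphi_2(c_3z)$;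 $a_{31}(z)=c_3\varphi_1(c_3z)-a_{32}(z)$; $a_{42}(z)=\frac{\gamma}{\gamma c_2+c_3}\varphi_2(z)$; $a_{43}(z)=\frac1{\gamma c_2+c_3}\varphi_2(z)$; $a_{41}(z)=\varphi_1(z)-a_{42}(z)-a_{43}(z)$. Differentiation matrix ($s=3$): $\underline a_{i+1,i}:=a_{i+1,i}$, $\underline a_{i+1,j}:=a_{i+1,j}-a_{i,j}$ for $1\le j\le i-1$; $\underline\theta_{k,k}:=1/\underline a_{k+1,k}$, $\underline\theta_{k,j}:=-\sum_{\ell=j+1}^{k}\underline\theta_{k,\ell}\,\underline a_{\ell+1,j}/\underline a_{j+1,j}$ for $1\le j\le k-1$; $d_{k\ell}(z):=\underline\theta_{k\ell}(z)+\frac z2(2-\delta_{k\ell})$ for $1\le\ell\le k\le s$ ($\delta_{k\ell}$ the Kronecker delta) and $d_{k\ell}:=0$ for $\ell>k$. These $d_{k\ell}$ are denoted $d^{(3,2)}_{k\ell}(c_2,c_3,z)$. *)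

theory Defs
  imports "HOL-Analysis.Analysis"
begin

text \<open>The value at \<open>z = 0\<close> is the continuous extension, see \<open>phi_sums\<close> and \<open>isCont_phi\<close>.\<close>

fun phi :: "nat \<Rightarrow> real \<Rightarrow> real" where
  "phi 0 z = exp z"
| "phi (Suc k) z = (if z = 0 then 1 / fact (Suc k) else (phi k z - 1 / fact k) / z)"

lemma phi_sums: "(\<lambda>m. z ^ m / fact (m + k)) sums phi k z"
proof (induction k)
  case 0
  show ?case
    using exp_converges[of z] by (simp add: divide_inverse mult.commute)
next
  case (Suc k)
  show ?case
  proof (cases "z = 0")
    case True
    with powser_sums_zero[of "\<lambda>m. 1 / fact (m + Suc k) :: real"] show ?thesis
      by (simp del: fact_Suc add_Suc_right)
  next
    case False
    have "(\<lambda>m. z ^ Suc m / fact (Suc m + k)) sums (phi k z - 1 / fact k)"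
      using Suc.IH sums_Suc_iff[of "\<lambda>m. z ^ m / fact (m + k)" "phi k z - 1 / fact k"]
      by simp
    from sums_divide[OF this, of z] False show ?thesis
      by (simp del: fact_Suc)
  qed
qed

lemma isCont_phi: "isCont (phi k) z"
proof -
  have eq: "phi k = (\<lambda>x. \<Sum>m. (1 / fact (m + k)) * x ^ m)"
    using phi_sums[of _ k] by (simp add: fun_eq_iff sums_iff)
  have sm: "summable (\<lambda>m. (1 / fact (m + k)) * x ^ m)" for x :: real
    using phi_sums[of x k] by (simp add: sums_iff)
  show ?thesis
    unfolding eq by (rule isCont_powser[OF sm[of "norm z + 1"]]) simp
qed

definition diag_mat :: "('n::finite \<Rightarrow> real) \<Rightarrow> real ^ 'n ^ 'n" where
  "diag_mat d = (\<chi> i j. if i = j then d i else 0)"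

text \<open>
  The matrix function \<open>f(A) = Q diag(f(d\<^sub>1), \<dots>, f(d\<^sub>M)) Q\<^sup>T\<close> of a symmetric matrix
  \<open>A = Q diag(d\<^sub>1, \<dots>, d\<^sub>M) Q\<^sup>T\<close> with \<open>Q\<close> orthogonal. Such a factorization exists by the
  spectral theorem, and \<open>f(A)\<close> does not depend on its choice.  Nothing is intended for
  non-symmetric \<open>A\<close>.
\<close>

definition sym_matfun :: "(real \<Rightarrow> real) \<Rightarrow> real ^ 'n ^ 'n \<Rightarrow> real ^ 'n ^ 'n" where
  "sym_matfun f A = (THE B. \<exists>Q d. orthogonal_matrix Q
      \<and> A = Q ** diag_mat d ** transpose Q
      \<and> B = Q ** diag_mat (\<lambda>i. f (d i)) ** transpose Q)"

lemma sym_matfun_eqI: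
  fixes A Q :: "real ^ 'n ^ 'n"
  assumes Q: "orthogonal_matrix Q" and A: "A = Q ** diag_mat d ** transpose Q"
  shows "sym_matfun f A = Q ** diag_mat (\<lambda>i. f (d i)) ** transpose Q"
  unfolding sym_matfun_def
proof (rule the_equality)
  show "\<exists>Q' d'. orthogonal_matrix Q' \<and> A = Q' ** diag_mat d' ** transpose Q'
      \<and> Q ** diag_mat (\<lambda>i. f (d i)) ** transpose Q = Q' ** diag_mat (\<lambda>i. f (d' i)) ** transpose Q'"
    using assms by blast
next
  fix B
  assume "\<exists>Q' d'. orthogonal_matrix Q' \<and> A = Q' ** diag_mat d' ** transpose Q'
      \<and> B = Q' ** diag_mat (\<lambda>i. f (d' i)) ** transpose Q'"
  then obtain P e where P: "orthogonal_matrix P" and AP: "A = P ** diag_mat e ** transpose P"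
    and B: "B = P ** diag_mat (\<lambda>i. f (e i)) ** transpose P"
    by blast
  define R where "R = transpose P ** Q"
  have QQ: "transpose Q ** Q = mat 1" "Q ** transpose Q = mat 1"
    and PP: "transpose P ** P = mat 1" "P ** transpose P = mat 1"
    using Q P by (auto simp: orthogonal_matrix_def)
  have PA: "transpose P ** A = diag_mat e ** transpose P"
    unfolding AP by (simp add: matrix_mul_assoc PP)
  have AQ: "A ** Q = Q ** diag_mat d"
    unfolding A by (simp add: matrix_mul_assoc[symmetric] QQ)
  have "diag_mat e ** R = transpose P ** A ** Q"
    unfolding R_def by (simp add: matrix_mul_assoc PA)
  also have "\<dots> = R ** diag_mat d"
    unfolding R_def by (simp add: matrix_mul_assoc[symmetric] AQ)
  finally have comm: "diag_mat e ** R = R ** diag_mat d" .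
  have ent: "(diag_mat h ** R) $ i $ j = h i * R $ i $ j"
    "(R ** diag_mat h) $ i $ j = R $ i $ j * h j" for h i j
    by (simp_all add: matrix_matrix_mult_def diag_mat_def if_distrib[where f="\<lambda>x. x * _"]
        if_distrib[where f="\<lambda>x. _ * x"] cong: if_cong)
  have eR: "e i * R $ i $ j = R $ i $ j * d j" for i j
    using comm ent by metis
  have "f (e i) * R $ i $ j = R $ i $ j * f (d j)" for i j
    using eR[of i j] by (cases "R $ i $ j = 0") auto
  then have "diag_mat (\<lambda>i. f (e i)) ** R = R ** diag_mat (\<lambda>i. f (d i))"
    by (simp add: vec_eq_iff ent)
  then have "P ** (diag_mat (\<lambda>i. f (e i)) ** R) ** transpose Q
      = P ** (R ** diag_mat (\<lambda>i. f (d i))) ** transpose Q"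
    by simp
  moreover have "P ** (diag_mat (\<lambda>i. f (e i)) ** R) ** transpose Q = B"
    unfolding R_def B by (simp add: matrix_mul_assoc[symmetric] QQ)
  moreover have "P ** (R ** diag_mat (\<lambda>i. f (d i))) ** transpose Q
      = Q ** diag_mat (\<lambda>i. f (d i)) ** transpose Q"
    unfolding R_def by (simp add: matrix_mul_assoc PP)
  ultimately show "B = Q ** diag_mat (\<lambda>i. f (d i)) ** transpose Q" by simp
qed

text \<open>
  Coefficient functions are indexed from \<open>1\<close>: \<open>a (i + 1) j\<close> with \<open>1 \<le> j \<le> i \<le> s\<close>; all other
  values are irrelevant.  The family is meant for \<open>c2 \<noteq> 0\<close>, \<open>c2 \<noteq> 2/3\<close>, \<open>c3 \<noteq> c2\<close> and
  \<open>c3 \<noteq> 2/3\<close>.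
\<close>

definition eerk32_gamma :: "real \<Rightarrow> real \<Rightarrow> real" where
  "eerk32_gamma c2 c3 = ((3 * c3 - 2) * c3) / ((2 - 3 * c2) * c2)"

definition eerk32_a32 :: "real \<Rightarrow> real \<Rightarrow> real \<Rightarrow> real" where
  "eerk32_a32 c2 c3 z = eerk32_gamma c2 c3 * c2 * phi 2 (c2 * z) + c3\<^sup>2 / c2 * phi 2 (c3 * z)"

definition eerk32_a42 :: "real \<Rightarrow> real \<Rightarrow> real \<Rightarrow> real" where
  "eerk32_a42 c2 c3 z = eerk32_gamma c2 c3 / (eerk32_gamma c2 c3 * c2 + c3) * phi 2 z"

definition eerk32_a43 :: "real \<Rightarrow> real \<Rightarrow> real \<Rightarrow> real" where
  "eerk32_a43 c2 c3 z = 1 / (eerk32_gamma c2 c3 * c2 + c3) * phi 2 z"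

definition eerk32 :: "real \<Rightarrow> real \<Rightarrow> nat \<Rightarrow> nat \<Rightarrow> real \<Rightarrow> real" where
  "eerk32 c2 c3 i j z =
    (if (i, j) = (2, 1) then c2 * phi 1 (c2 * z)
     else if (i, j) = (3, 1) then c3 * phi 1 (c3 * z) - eerk32_a32 c2 c3 z
     else if (i, j) = (3, 2) then eerk32_a32 c2 c3 z
     else if (i, j) = (4, 1) then phi 1 z - eerk32_a42 c2 c3 z - eerk32_a43 c2 c3 z
     else if (i, j) = (4, 2) then eerk32_a42 c2 c3 z
     else if (i, j) = (4, 3) then eerk32_a43 c2 c3 z
     else 0)"

definition stab_op :: "real \<Rightarrow> real ^ 'm ^ 'm \<Rightarrow> real ^ 'm ^ 'm" where
  "stab_op \<kappa> L = L + \<kappa> *\<^sub>R mat 1"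

definition stab_nonlin :: "real \<Rightarrow> (real ^ 'm \<Rightarrow> real ^ 'm) \<Rightarrow> real ^ 'm \<Rightarrow> real ^ 'm" where
  "stab_nonlin \<kappa> g v = g v + \<kappa> *\<^sub>R v"

text \<open>
  \<open>u\<close> is the sequence of numerical solutions and \<open>U n 1, \<dots>, U n (s + 1)\<close> are the stages of the
  step from \<open>u (n - 1)\<close> to \<open>u n\<close>.
\<close>

definition eerk_solution ::
  "nat \<Rightarrow> (nat \<Rightarrow> nat \<Rightarrow> real \<Rightarrow> real) \<Rightarrow> real \<Rightarrow> real \<Rightarrow> real ^ 'm ^ 'm \<Rightarrow> (real ^ 'm \<Rightarrow> real ^ 'm)
    \<Rightarrow> (nat \<Rightarrow> real ^ 'm) \<Rightarrow> (nat \<Rightarrow> nat \<Rightarrow> real ^ 'm) \<Rightarrow> bool" where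
  "eerk_solution s a \<tau> \<kappa> L g u U \<longleftrightarrow>
    (\<forall>n\<ge>1.
      U n 1 = u (n - 1) \<and>
      (\<forall>i\<in>{1..s}.
        U n (i + 1) = U n 1 +
          (\<Sum>j=1..i. sym_matfun (a (i + 1) j) (- \<tau> *\<^sub>R stab_op \<kappa> L)
             *v (\<tau> *\<^sub>R stab_nonlin \<kappa> g (U n j) - \<tau> *\<^sub>R (stab_op \<kappa> L *v U n 1)))) \<and>
      u n = U n (s + 1))"

definition diff_coeff :: "(nat \<Rightarrow> nat \<Rightarrow> real \<Rightarrow> real) \<Rightarrow> nat \<Rightarrow> nat \<Rightarrow> real \<Rightarrow> real" where
  "diff_coeff a i j z = (if i = j + 1 then a i j z else a i j z - a (i - 1) j z)"

function dis_theta :: "(nat \<Rightarrow> nat \<Rightarrow> real \<Rightarrow> real) \<Rightarrow> nat \<Rightarrow> nat \<Rightarrow> real \<Rightarrow> real" where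
  "dis_theta a k j z =
    (if j = k then 1 / diff_coeff a (k + 1) k z
     else if j < k then
       - (\<Sum>l=j+1..k. dis_theta a k l z * diff_coeff a (l + 1) j z / diff_coeff a (j + 1) j z)
     else 0)"
  by pat_completeness auto
termination
  by (relation "inv_image less_than (\<lambda>(a, k, j, z). k - j)") auto

declare dis_theta.simps [simp del]

definition diff_matrix :: "(nat \<Rightarrow> nat \<Rightarrow> real \<Rightarrow> real) \<Rightarrow> nat \<Rightarrow> nat \<Rightarrow> real \<Rightarrow> real" where
  "diff_matrix a k l z =
    (if l \<le> k then dis_theta a k l z + z / 2 * (2 - (if k = l then 1 else 0)) else 0)"

definition energy :: "real ^ 'm ^ 'm \<Rightarrow> (real ^ 'm \<Rightarrow> real ^ 'm) \<Rightarrow> real ^ 'm \<Rightarrow> real" where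
  "energy L G v = 1 / 2 * (v \<bullet> (L *v v)) + G v \<bullet> (\<chi> i. 1)"

definition stage_diff :: "(nat \<Rightarrow> real ^ 'm) \<Rightarrow> nat \<Rightarrow> real ^ 'm" where
  "stage_diff V k = V (k + 1) - V k"

text \<open>
  The discrete counterpart of \<open>-\<langle>du/dt, du/dt\<rangle>\<close>, accumulated over the first \<open>j\<close> stages
  \<open>V 1, \<dots>, V (j + 1)\<close> of one step.
\<close>

definition dissipation ::
  "(nat \<Rightarrow> nat \<Rightarrow> real \<Rightarrow> real) \<Rightarrow> real \<Rightarrow> real ^ 'm ^ 'm \<Rightarrow> (nat \<Rightarrow> real ^ 'm) \<Rightarrow> nat \<Rightarrow> real" where
  "dissipation d \<tau> A V j =
    - (1 / \<tau>) * (\<Sum>k=1..j. stage_diff V k \<bullet> (\<Sum>l=1..k. sym_matfun (d k l) (- \<tau> *\<^sub>R A) *v stage_diff V l))"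

end

(* Summing the differentiation matrix against the stage increments inverts the triangular scheme:
   row k gives tau (g_kappa(U^k) - L_kappa (U^k + U^(k+1)) / 2).  Testing it with U^(k+1) - U^k and using
   the Lipschitz bound for the remainder of G yields the energy estimate step by step.

   The sign of the dissipation is decided on each eigenvalue z = -x < 0 of -tau L_kappa.  With
   f = phi_2(-x), h = phi_2(-x/2), b = x / (e^x - 1) and c = 1 / ((e^(x/2) + 1) (f + h)) the entries are
     d11 = x / (1 - e^(-x)) - x/2,   d22 = 4 / (f + h) - x/2,   d33 = 3 / (4 f) - x/2,
     d21 = 4 c + b,   d31 = b - c,   d32 = 3 / (4 f) - 1 / (f + h) - x.
   Here d11 >= 1, |d21| <= 3 and |d31| <= 1/2, and the form in the remaining two variables is
   controlled by rational bounds on f and h.  Only the 3 x 3 form is needed: for j < 3 set the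
   later increments to zero. *)

theory Submission
  imports Defs
begin

section \<open>Diagonalization of symmetric matrices\<close>

text \<open>First-order optimality in algebraic form: a parabola through the origin that never
  becomes positive has zero slope there.\<close>

lemma quadratic_nonpos_imp_linear_zero:
  fixes \<alpha> \<beta> :: real
  assumes "\<And>t. 2 * t * \<alpha> + t\<^sup>2 * \<beta> \<le> 0"
  shows "\<alpha> = 0"
proof (rule ccontr)
  assume "\<alpha> \<noteq> 0"
  \<comment> \<open>The step is so short that the linear term outweighs
    \<open>s\<^sup>2 * \<beta>\<close> whatever the sign of \<open>\<beta>\<close>.\<close>
  define s where "s = \<alpha> / (1 + \<bar>\<beta>\<bar>)"
  have s: "\<alpha> = s * (1 + \<bar>\<beta>\<bar>)" and "s \<noteq> 0"
    using \<open>\<alpha> \<noteq> 0\<close> by (auto simp: s_def)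
  have "2 * s * \<alpha> + s\<^sup>2 * \<beta> = s\<^sup>2 * (2 + 2 * \<bar>\<beta>\<bar> + \<beta>)"
    unfolding s by (simp add: algebra_simps power2_eq_square)
  moreover have "\<dots> > 0"
    using \<open>s \<noteq> 0\<close> by (intro mult_pos_pos) auto
  ultimately show False
    using assms[of s] by simp
qed

lemma symmetric_inner:
  fixes A :: "real ^ 'n ^ 'n"
  assumes "transpose A = A"
  shows "x \<bullet> (A *v y) = (A *v x) \<bullet> y"
  by (metis assms dot_lmul_matrix vector_transpose_matrix)

text \<open>A maximiser of the Rayleigh quotient over the unit sphere of an invariant subspace is an eigenvector.\<close>

lemma symmetric_eigenvector_in_invariant_subspace:
  fixes A :: "real ^ 'n ^ 'n"
  assumes sym: "transpose A = A" and S: "subspace S" and nz: "S \<noteq> {0}"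
    and inv: "\<And>x. x \<in> S \<Longrightarrow> A *v x \<in> S"
  obtains v m where "v \<in> S" "norm v = 1" "A *v v = m *\<^sub>R v"
proof -
  let ?K = "S \<inter> sphere 0 1"
  obtain x where x: "x \<in> S" "x \<noteq> 0"
    using nz subspace_0[OF S] by blast
  have "x /\<^sub>R norm x \<in> ?K"
    using x S by (simp add: subspace_scale)
  moreover have "compact ?K"
    by (intro closed_Int_compact closed_subspace S) simp
  moreover have "continuous_on ?K (\<lambda>x. x \<bullet> (A *v x))"
    by (intro continuous_intros matrix_vector_mult_linear_continuous_on)
  ultimately obtain v where v: "v \<in> ?K" and mx: "\<And>y. y \<in> ?K \<Longrightarrow> y \<bullet> (A *v y) \<le> v \<bullet> (A *v v)"
    using continuous_attains_sup[of ?K "\<lambda>x. x \<bullet> (A *v x)"] by blast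
  define m where "m = v \<bullet> (A *v v)"
  have vv: "v \<in> S" "norm v = 1" "v \<bullet> v = 1"
    using v by (auto simp: norm_eq_1)
  have le: "y \<bullet> (A *v y) \<le> m * (y \<bullet> y)" if "y \<in> S" for y
  proof (cases "y = 0")
    case False
    have "(y /\<^sub>R norm y) \<bullet> (A *v (y /\<^sub>R norm y)) \<le> m"
      unfolding m_def using False that S by (intro mx) (simp add: subspace_scale)
    then have "(y \<bullet> (A *v y)) / (norm y)\<^sup>2 \<le> m"
      by (simp add: matrix_vector_mult_scaleR power2_eq_square field_simps)
    then show ?thesis
      using False by (simp add: divide_le_eq power2_norm_eq_inner)
  qed simp
  define w where "w = A *v v - m *\<^sub>R v"
  have w: "w \<in> S"
    unfolding w_def using vv S inv by (intro subspace_diff subspace_scale) auto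
  \<comment> \<open>The maximiser is perturbed along its own residual \<open>w\<close>, which stays
    in \<open>S\<close> by invariance. The first-order term is \<open>2 * t\<close> times the
    squared norm of \<open>w\<close>.\<close>
  have "w \<bullet> (A *v v - m *\<^sub>R v) = 0"
  proof (rule quadratic_nonpos_imp_linear_zero)
    fix t
    have "v + t *\<^sub>R w \<in> S"
      using vv w S by (intro subspace_add subspace_scale) auto
    from le[OF this] show "2 * t * (w \<bullet> (A *v v - m *\<^sub>R v)) + t\<^sup>2 * (w \<bullet> (A *v w) - m * (w \<bullet> w)) \<le> 0"
      using symmetric_inner[OF sym, of v w] vv
      by (simp add: matrix_vector_right_distrib matrix_vector_mult_scaleR inner_add_left inner_add_right
          inner_diff_right inner_commute m_def[symmetric] algebra_simps power2_eq_square)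
  qed
  then have "w = 0"
    by (simp add: w_def[symmetric])
  then show ?thesis
    using that[of v m] vv by (simp add: w_def)
qed

text \<open>Induction on \<open>k\<close>: by symmetry the orthogonal complement of the eigenvectors
  found so far is invariant. It is nontrivial while their number is below the dimension, so it
  contains a further eigenvector.\<close>

lemma symmetric_orthonormal_eigenvectors:
  fixes A :: "real ^ 'n ^ 'n"
  assumes sym: "transpose A = A" and "k \<le> CARD('n)"
  shows "\<exists>B. finite B \<and> card B = k \<and> pairwise orthogonal B
    \<and> (\<forall>b\<in>B. norm b = 1 \<and> (\<exists>m. A *v b = m *\<^sub>R b))"
  using \<open>k \<le> CARD('n)\<close>
proof (induction k)
  case 0
  show ?case by (intro exI[of _ "{}"]) auto
next
  case (Suc k)
  then obtain B where B: "finite B" "card B = k" "pairwise orthogonal B"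
    and eig: "\<And>b. b \<in> B \<Longrightarrow> norm b = 1 \<and> (\<exists>m. A *v b = m *\<^sub>R b)"
    by auto
  define S where "S = {y. \<forall>x\<in>B. orthogonal x y}"
  have S: "subspace S"
    unfolding S_def by (rule subspace_orthogonal_to_vectors)
  have "dim B < DIM(real ^ 'n)"
    using dim_le_card'[OF B(1)] B(2) Suc.prems by simp
  then obtain x where "x \<noteq> 0" and x: "\<And>y. y \<in> span B \<Longrightarrow> orthogonal x y"
    using orthogonal_to_subspace_exists by blast
  have "x \<in> S"
    unfolding S_def using x by (auto simp: orthogonal_commute span_base)
  then have nz: "S \<noteq> {0}"
    using \<open>x \<noteq> 0\<close> by auto
  have inv: "A *v y \<in> S" if "y \<in> S" for y
  proof -
    have "b \<bullet> (A *v y) = 0" if "b \<in> B" for b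
      using eig[OF that] \<open>y \<in> S\<close> that by (auto simp: symmetric_inner[OF sym] S_def orthogonal_def)
    then show ?thesis
      by (auto simp: S_def orthogonal_def)
  qed
  obtain v m where v: "v \<in> S" "norm v = 1" "A *v v = m *\<^sub>R v"
    using symmetric_eigenvector_in_invariant_subspace[OF sym S nz inv] by blast
  have "v \<notin> B"
    using v by (auto simp: S_def orthogonal_def)
  then show ?case
    using B eig v
    by (intro exI[of _ "insert v B"])
      (auto simp: pairwise_insert S_def orthogonal_commute)
qed

text \<open>Supplies the factorization that gives the description in \<open>sym_matfun\<close> a
  value. The columns of \<open>Q\<close> are orthonormal eigenvectors.\<close>

theorem symmetric_matrix_diagonalizable:
  fixes A :: "real ^ 'n ^ 'n"
  assumes sym: "transpose A = A"
  obtains Q d where "orthogonal_matrix Q" "A = Q ** diag_mat d ** transpose Q"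
proof -
  obtain B where B: "finite B" "card B = CARD('n)" "pairwise orthogonal B"
    and eig: "\<And>b. b \<in> B \<Longrightarrow> norm b = 1 \<and> (\<exists>m. A *v b = m *\<^sub>R b)"
    using symmetric_orthonormal_eigenvectors[OF sym, of "CARD('n)"] by auto
  obtain q where q: "bij_betw q (UNIV :: 'n set) B"
    using B finite_same_card_bij[of "UNIV :: 'n set" B] by auto
  have qB: "q i \<in> B" for i
    using q by (auto simp: bij_betw_def)
  have "\<forall>i. \<exists>m. A *v q i = m *\<^sub>R q i"
    using eig qB by blast
  from choice[OF this] obtain d where d: "\<And>i. A *v q i = d i *\<^sub>R q i"
    by blast
  define Q :: "real ^ 'n ^ 'n" where "Q = (\<chi> i j. q j $ i)"
  have colQ: "column j Q = q j" for j
    by (simp add: Q_def column_def)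
  have "q i \<noteq> q j" if "i \<noteq> j" for i j
    using q that by (auto simp: bij_betw_def dest: injD)
  then have Q: "orthogonal_matrix Q"
    unfolding orthogonal_matrix_orthonormal_columns colQ
    using eig qB B(3) by (simp add: pairwise_def)
  have "A ** Q = Q ** diag_mat d"
  proof -
    have "(A ** Q) $ i $ j = (A *v q j) $ i" for i j
      by (simp add: matrix_matrix_mult_def matrix_vector_mult_def Q_def)
    moreover have "(Q ** diag_mat d) $ i $ j = d j * q j $ i" for i j
      by (simp add: matrix_matrix_mult_def diag_mat_def Q_def if_distrib mult.commute cong: if_cong)
    ultimately show ?thesis
      by (simp add: vec_eq_iff d)
  qed
  then have "Q ** diag_mat d ** transpose Q = A ** (Q ** transpose Q)"
    by (simp add: matrix_mul_assoc)
  also have "\<dots> = A"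
    using Q by (simp add: orthogonal_matrix_def)
  finally show ?thesis
    by (intro that[OF Q, of d]) simp
qed

section \<open>Bounds for the function \<open>\<phi>\<^sub>2\<close>\<close>

text \<open>Applied repeatedly, this proves inequalities between polynomials and exponentials by
  differentiating until the sign is evident.\<close>

lemma nonneg_if_deriv_nonneg:
  fixes f :: "real \<Rightarrow> real"
  assumes "\<And>t. 0 \<le> t \<Longrightarrow> (f has_real_derivative f' t) (at t)"
    and "\<And>t. 0 \<le> t \<Longrightarrow> 0 \<le> f' t" and "0 \<le> f 0" and "0 \<le> x"
  shows "0 \<le> f x"
  using DERIV_nonneg_imp_nondecreasing[of 0 x f] assms by (meson order_trans)

lemma phi_1_minus: "x \<noteq> 0 \<Longrightarrow> phi 1 (- x) = (1 - exp (- x)) / x"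
  by (simp add: divide_simps)

lemma phi_2_minus: "x \<noteq> 0 \<Longrightarrow> phi 2 (- x) = (x - 1 + exp (- x)) / x\<^sup>2"
  by (simp add: numeral_2_eq_2 divide_simps)

text \<open>For \<open>x > 0\<close> this is \<open>x / 2 * coth (x / 2) \<ge> 1\<close> without
  denominators. It yields both a lower bound for \<open>phi 2\<close> and the bound on the first
  diagonal entry.\<close>

lemma two_minus_mult_exp_le:
  fixes x :: real
  assumes "0 \<le> x"
  shows "(2 - x) * exp x \<le> 2 + x"
proof -
  have 1: "0 \<le> 1 + (t - 1) * exp t" if "0 \<le> t" for t :: real
    by (rule nonneg_if_deriv_nonneg[where f = "\<lambda>t. 1 + (t - 1) * exp t" and f' = "\<lambda>t. t * exp t"])
      (use that in \<open>auto intro!: derivative_eq_intros simp: algebra_simps\<close>)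
  have "0 \<le> 2 + x + (x - 2) * exp x"
    by (rule nonneg_if_deriv_nonneg[where f = "\<lambda>t. 2 + t + (t - 2) * exp t" and
          f' = "\<lambda>t. 1 + (t - 1) * exp t"])
      (use assms 1 in \<open>auto intro!: derivative_eq_intros simp: algebra_simps\<close>)
  then show ?thesis
    by (simp add: algebra_simps)
qed

text \<open>Since \<open>(1 + x) * (x - 1) = x\<^sup>2 - 1\<close>, only
  \<open>(1 + x) * exp (- x) \<le> 1\<close> is left. The bound is sharp as \<open>x\<close> tends
  to infinity.\<close>

lemma phi_2_upper_linear:
  assumes "0 < x"
  shows "(1 + x) * phi 2 (- x) \<le> 1"
proof -
  have "(1 + x) * exp (- x) \<le> 1"
    using exp_ge_add_one_self[of x] by (simp add: exp_minus field_simps)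
  then have "(1 + x) * (x - 1 + exp (- x)) \<le> x\<^sup>2"
    by (simp add: algebra_simps power2_eq_square)
  then show ?thesis
    using assms by (simp add: phi_2_minus divide_simps)
qed

text \<open>The line \<open>2 + 2 * x / 3\<close> is the tangent at \<open>0\<close> to the
  reciprocal of \<open>phi 2 (- x)\<close>, so this bound is sharp for small
  \<open>x\<close>.\<close>

lemma phi_2_upper_tangent:
  assumes "0 < x"
  shows "(2 + 2 * x / 3) * phi 2 (- x) \<le> 1"
proof -
  have 1: "0 \<le> (t\<^sup>2 - 2 * t + 2) * exp t - 2" if "0 \<le> t" for t :: real
    by (rule nonneg_if_deriv_nonneg[where f = "\<lambda>t. (t\<^sup>2 - 2 * t + 2) * exp t - 2" and
          f' = "\<lambda>t. t\<^sup>2 * exp t"])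
      (use that in \<open>auto intro!: derivative_eq_intros simp: algebra_simps power2_eq_square\<close>)
  have "0 \<le> (x\<^sup>2 - 4 * x + 6) * exp x - 6 - 2 * x"
    by (rule nonneg_if_deriv_nonneg[where f = "\<lambda>t. (t\<^sup>2 - 4 * t + 6) * exp t - 6 - 2 * t" and
          f' = "\<lambda>t. (t\<^sup>2 - 2 * t + 2) * exp t - 2"])
      (use assms 1 in \<open>auto intro!: derivative_eq_intros simp: algebra_simps power2_eq_square\<close>)
  then have "(6 + 2 * x) * exp (- x) \<le> x\<^sup>2 - 4 * x + 6"
    by (simp add: exp_minus field_simps)
  then have "(2 + 2 * x / 3) * (x - 1 + exp (- x)) \<le> x\<^sup>2"
    by (simp add: field_simps power2_eq_square)
  then show ?thesis
    using assms by (simp add: phi_2_minus divide_simps)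
qed

lemma phi_2_lower_linear:
  assumes "0 < x"
  shows "1 \<le> (2 + x) * phi 2 (- x)"
proof -
  have "2 - x \<le> (2 + x) * exp (- x)"
    using two_minus_mult_exp_le[of x] assms by (simp add: exp_minus field_simps)
  then have "x\<^sup>2 \<le> (2 + x) * (x - 1 + exp (- x))"
    by (simp add: algebra_simps power2_eq_square)
  then show ?thesis
    using assms by (simp add: phi_2_minus divide_simps)
qed

lemma phi_2_pos:
  assumes "0 < x"
  shows "0 < phi 2 (- x)"
  using phi_2_lower_linear[OF assms] assms
  by (metis add_pos_pos less_le_trans zero_less_mult_pos zero_less_numeral zero_less_one)

lemma phi_2_le_half:
  assumes "0 < x"
  shows "phi 2 (- x) \<le> 1 / 2"
proof -
  have "2 * phi 2 (- x) \<le> (2 + 2 * x / 3) * phi 2 (- x)"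
    using assms phi_2_pos[OF assms] by (intro mult_right_mono) auto
  then show ?thesis
    using phi_2_upper_tangent[OF assms] by simp
qed

text \<open>Jensen's inequality for \<open>\<phi>\<^sub>2(-x) = \<integral>\<^sub>0\<^sup>1 (1 - s) exp (- s x) ds\<close>: the mean of \<open>s\<close> under the weight
  \<open>1 - s\<close> is \<open>1/3\<close>.\<close>

lemma phi_2_lower_exp:
  assumes "0 < x"
  shows "exp (- (x / 3)) \<le> 2 * phi 2 (- x)"
proof -
  \<comment> \<open>Multiplying the claim by \<open>x\<^sup>2 / 2 * exp (x / 3)\<close> leaves one
    function to be shown nonnegative. Fact \<open>2\<close> is about its first derivative, fact
    \<open>1\<close> about nine times its second.\<close>
  have 1: "0 \<le> (5 + t) * exp (t / 3) + 4 * exp (- (2 * t / 3)) - 9" if "0 \<le> t" for t :: real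
  proof -
    have "(5 + t) * (1 + t / 3) \<le> (5 + t) * exp (t / 3)"
      using that by (intro mult_left_mono exp_ge_add_one_self) auto
    moreover have "4 * (1 - 2 * t / 3) \<le> 4 * exp (- (2 * t / 3))"
      using exp_ge_add_one_self[of "- (2 * t / 3)"] by simp
    moreover have "(5 + t) * (1 + t / 3) + 4 * (1 - 2 * t / 3) = 9 + t\<^sup>2 / 3"
      by (simp add: algebra_simps power2_eq_square)
    moreover have "0 \<le> t\<^sup>2 / 3"
      by simp
    ultimately show ?thesis
      by linarith
  qed
  have 2: "0 \<le> (2 + t) / 3 * exp (t / 3) - 2 / 3 * exp (- (2 * t / 3)) - t" if "0 \<le> t" for t :: real
  proof (rule nonneg_if_deriv_nonneg
        [where f = "\<lambda>t. (2 + t) / 3 * exp (t / 3) - 2 / 3 * exp (- (2 * t / 3)) - t" and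
          f' = "\<lambda>t. ((5 + t) * exp (t / 3) + 4 * exp (- (2 * t / 3)) - 9) / 9"])
    fix t :: real
    show "((\<lambda>t. (2 + t) / 3 * exp (t / 3) - 2 / 3 * exp (- (2 * t / 3)) - t) has_real_derivative
        ((5 + t) * exp (t / 3) + 4 * exp (- (2 * t / 3)) - 9) / 9) (at t)"
      by (auto intro!: derivative_eq_intros simp: field_simps)
  qed (use that 1 in simp_all)
  have "0 \<le> (x - 1) * exp (x / 3) + exp (- (2 * x / 3)) - x\<^sup>2 / 2"
  proof (rule nonneg_if_deriv_nonneg
        [where f = "\<lambda>x. (x - 1) * exp (x / 3) + exp (- (2 * x / 3)) - x\<^sup>2 / 2" and
          f' = "\<lambda>t. (2 + t) / 3 * exp (t / 3) - 2 / 3 * exp (- (2 * t / 3)) - t"])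
    fix t :: real
    show "((\<lambda>x. (x - 1) * exp (x / 3) + exp (- (2 * x / 3)) - x\<^sup>2 / 2) has_real_derivative
        (2 + t) / 3 * exp (t / 3) - 2 / 3 * exp (- (2 * t / 3)) - t) (at t)"
      by (auto intro!: derivative_eq_intros simp: field_simps)
  qed (use assms 2 in simp_all)
  moreover define a where "a = exp (x / 3)"
  moreover have "exp (- (2 * x / 3)) = 1 / a\<^sup>2" "exp (- (x / 3)) = 1 / a" "exp (- x) = 1 / a ^ 3"
    using exp_of_nat_mult[of 2 "x / 3"] exp_of_nat_mult[of 3 "x / 3"]
    by (simp_all add: a_def exp_minus inverse_eq_divide)
  moreover have "a > 0"
    by (simp add: a_def)
  ultimately have "1 / a * (x\<^sup>2 / 2) \<le> 1 / a * ((x - 1) * a + 1 / a\<^sup>2)"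
    by (intro mult_left_mono) auto
  also have "\<dots> = x - 1 + 1 / a ^ 3"
    using \<open>a > 0\<close> by (simp add: field_simps power2_eq_square power3_eq_cube)
  finally show ?thesis
    using assms by (simp add: phi_2_minus \<open>exp (- (x / 3)) = _\<close> \<open>exp (- x) = _\<close> field_simps)
qed

text \<open>With \<open>E = exp (- (x / 2))\<close>, both values times \<open>x\<^sup>2\<close> are
  polynomials in \<open>x\<close> and \<open>E\<close>. The second bound reduces to
  \<open>2 * (1 - E)\<^sup>2 \<ge> 0\<close>, the first to a function with derivative
  \<open>(1 - E)\<^sup>2\<close>.\<close>

lemma phi_2_half_bounds:
  assumes "0 < x"
  shows "phi 2 (- x) \<le> phi 2 (- (x / 2))" and "phi 2 (- (x / 2)) \<le> 2 * phi 2 (- x)"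
proof -
  define E where "E = exp (- (x / 2))"
  have E2: "exp (- x) = E\<^sup>2"
    unfolding E_def by (simp add: exp_double[symmetric])
  define F where "F t = t - (1 - exp (- (t / 2))) * (3 - exp (- (t / 2)))" for t :: real
  have "0 \<le> F x"
  proof (rule nonneg_if_deriv_nonneg[where f = F and f' = "\<lambda>t. (1 - exp (- (t / 2)))\<^sup>2"])
    fix t :: real
    show "(F has_real_derivative (1 - exp (- (t / 2)))\<^sup>2) (at t)"
      unfolding F_def by (auto intro!: derivative_eq_intros simp: field_simps power2_eq_square)
  qed (use assms in \<open>auto simp: F_def\<close>)
  then have "(1 - E) * (3 - E) \<le> x"
    by (simp add: F_def E_def)
  moreover have f: "phi 2 (- x) = (x - 1 + E\<^sup>2) / x\<^sup>2"
    using assms by (simp add: phi_2_minus E2)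
  moreover have h: "phi 2 (- (x / 2)) = (2 * x - 4 + 4 * E) / x\<^sup>2"
    using assms by (simp add: phi_2_minus flip: E_def) (simp add: field_simps power2_eq_square)
  ultimately show "phi 2 (- x) \<le> phi 2 (- (x / 2))"
    by (simp add: divide_right_mono algebra_simps power2_eq_square)
  have "0 \<le> 2 * (1 - E)\<^sup>2"
    by simp
  then have "2 * x - 4 + 4 * E \<le> 2 * (x - 1 + E\<^sup>2)"
    by (simp add: algebra_simps power2_eq_square)
  then show "phi 2 (- (x / 2)) \<le> 2 * phi 2 (- x)"
    unfolding f h by (simp only: times_divide_eq_right divide_right_mono zero_le_power2)
qed

section \<open>Positivity of the differentiation matrix\<close>

text \<open>For these abscissas \<open>eerk32_gamma\<close> equals \<open>1 / 4\<close> and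
  \<open>eerk32_gamma c2 c3 * c2 + c3\<close> equals \<open>3 / 4\<close>.\<close>

lemma eerk32_diff_coeff:
  fixes x :: real
  shows "diff_coeff (eerk32 1 (1/2)) 2 1 (- x) = phi 1 (- x)"
    and "diff_coeff (eerk32 1 (1/2)) 3 2 (- x) = (phi 2 (- x) + phi 2 (- (x / 2))) / 4"
    and "diff_coeff (eerk32 1 (1/2)) 4 3 (- x) = 4 / 3 * phi 2 (- x)"
    and "diff_coeff (eerk32 1 (1/2)) 3 1 (- x) =
      phi 1 (- (x / 2)) / 2 - (phi 2 (- x) + phi 2 (- (x / 2))) / 4 - phi 1 (- x)"
    and "diff_coeff (eerk32 1 (1/2)) 4 2 (- x) =
      phi 2 (- x) / 3 - (phi 2 (- x) + phi 2 (- (x / 2))) / 4"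
    and "diff_coeff (eerk32 1 (1/2)) 4 1 (- x) =
      phi 1 (- x) - 5 / 3 * phi 2 (- x) - phi 1 (- (x / 2)) / 2 + (phi 2 (- x) + phi 2 (- (x / 2))) / 4"
  by (simp_all add: diff_coeff_def eerk32_def eerk32_a32_def eerk32_a42_def eerk32_a43_def
      eerk32_gamma_def power2_eq_square add_divide_distrib del: phi.simps One_nat_def)

lemma phi_1_pos:
  assumes "0 < x"
  shows "0 < phi 1 (- x)"
  using assms by (simp add: phi_1_minus del: phi.simps One_nat_def)

text \<open>These are the denominators in \<open>dis_theta\<close>, so on the negative axis its
  recursion never meets a division by zero.\<close>

lemma eerk32_diff_coeff_pos:
  assumes "z < 0" and "k \<in> {1..3}"
  shows "0 < diff_coeff (eerk32 1 (1/2)) (k + 1) k z"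
proof -
  define x where "x = - z"
  then have x: "0 < x" and z: "z = - x"
    using assms by auto
  have "k = 1 \<or> k = 2 \<or> k = 3"
    using assms by auto
  then show ?thesis
    using phi_1_pos[OF x] phi_2_pos[OF x] phi_2_pos[of "x / 2"] x
    by (auto simp: z eerk32_diff_coeff simp del: phi.simps One_nat_def)
qed

lemma diff_matrix_expand:
  "diff_matrix a 1 1 z = 1 / diff_coeff a 2 1 z + z / 2"
  "diff_matrix a 2 2 z = 1 / diff_coeff a 3 2 z + z / 2"
  "diff_matrix a 3 3 z = 1 / diff_coeff a 4 3 z + z / 2"
  "diff_matrix a 2 1 z = - (1 / diff_coeff a 3 2 z * diff_coeff a 3 1 z / diff_coeff a 2 1 z) + z"
  "diff_matrix a 3 2 z = - (1 / diff_coeff a 4 3 z * diff_coeff a 4 2 z / diff_coeff a 3 2 z) + z"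
  "diff_matrix a 3 1 z =
    - (- (1 / diff_coeff a 4 3 z * diff_coeff a 4 2 z / diff_coeff a 3 2 z) * diff_coeff a 3 1 z / diff_coeff a 2 1 z
       + 1 / diff_coeff a 4 3 z * diff_coeff a 4 1 z / diff_coeff a 2 1 z) + z"
  by (simp_all add: diff_matrix_def dis_theta.simps eval_nat_numeral)

text \<open>With \<open>e = exp (x / 2)\<close> and \<open>p = phi 1 (- x)\<close>, the identities
  \<open>phi 1 (- (x / 2)) = 2 * p * e / (e + 1)\<close> and \<open>1 / p = x + b\<close> remove all
  values of \<open>phi 1\<close>; the rest is field arithmetic.\<close>

lemma eerk32_diff_matrix:
  fixes x :: real
  assumes "0 < x"
  defines "f \<equiv> phi 2 (- x)" and "h \<equiv> phi 2 (- (x / 2))"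
  defines "b \<equiv> x / (exp x - 1)" and "c \<equiv> 1 / ((exp (x / 2) + 1) * (f + h))"
  shows "diff_matrix (eerk32 1 (1/2)) 1 1 (- x) = x / (1 - exp (- x)) - x / 2"
    and "diff_matrix (eerk32 1 (1/2)) 2 2 (- x) = 4 / (f + h) - x / 2"
    and "diff_matrix (eerk32 1 (1/2)) 3 3 (- x) = 3 / (4 * f) - x / 2"
    and "diff_matrix (eerk32 1 (1/2)) 2 1 (- x) = 4 * c + b"
    and "diff_matrix (eerk32 1 (1/2)) 3 2 (- x) = 3 / (4 * f) - 1 / (f + h) - x"
    and "diff_matrix (eerk32 1 (1/2)) 3 1 (- x) = b - c"
proof -
  have f: "0 < f" and h: "0 < h"
    using phi_2_pos[of x] phi_2_pos[of "x / 2"] assms by (auto simp: f_def h_def)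
  define s where "s = f + h"
  have s: "0 < s"
    using f h by (simp add: s_def)
  define e where "e = exp (x / 2)"
  have e: "1 < e"
    using assms by (simp add: e_def)
  have e2: "exp x = e\<^sup>2"
    by (simp add: e_def exp_double[symmetric])
  have e2': "1 < e\<^sup>2"
    using e by (simp add: power2_eq_square) (simp add: less_1_mult)
  define p where "p = phi 1 (- x)"
  have p: "0 < p" and p_eq: "p = (1 - 1 / e\<^sup>2) / x"
    using assms phi_1_pos[of x]
    by (simp_all add: p_def phi_1_minus exp_minus e2 inverse_eq_divide del: phi.simps One_nat_def)
  have "p = (e - 1) * (e + 1) / (e\<^sup>2 * x)"
    using e assms(1) by (simp add: p_eq field_simps power2_eq_square)
  then have "2 * p * e / (e + 1) = 2 * (1 - 1 / e) / x"
    using e assms(1) by (simp add: power2_eq_square diff_divide_distrib)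
  then have q_eq: "phi 1 (- (x / 2)) = 2 * p * e / (e + 1)"
    using assms(1) by (simp add: phi_1_minus exp_minus inverse_eq_divide del: phi.simps One_nat_def flip: e_def)
  have p_inv: "1 / p = x + b"
  proof -
    have "e\<^sup>2 - 1 \<noteq> 0" "e \<noteq> 0"
      using e e2' by linarith+
    then show ?thesis
      using assms(1) by (simp add: p_eq b_def e2 divide_simps) (simp add: algebra_simps)
  qed
  note coeff = eerk32_diff_coeff[of x, folded f_def h_def p_def, folded s_def, unfolded q_eq]
  show "diff_matrix (eerk32 1 (1/2)) 1 1 (- x) = x / (1 - exp (- x)) - x / 2"
    unfolding diff_matrix_expand coeff p_def using assms
    by (simp add: phi_1_minus del: phi.simps One_nat_def)
  show "diff_matrix (eerk32 1 (1/2)) 2 2 (- x) = 4 / (f + h) - x / 2"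
    unfolding diff_matrix_expand coeff by (simp add: s_def)
  show "diff_matrix (eerk32 1 (1/2)) 3 3 (- x) = 3 / (4 * f) - x / 2"
    unfolding diff_matrix_expand coeff by simp
  define r where "r = 1 / (e + 1)"
  have c: "c = r / s"
    by (simp add: c_def r_def e_def s_def)
  have "e + 1 \<noteq> 0"
    using e by linarith
  then have pe: "2 * p * e / (e + 1) / 2 = p - p * r"
    by (simp add: r_def divide_simps) (simp add: algebra_simps)
  have t21: "- (1 / (s / 4) * (2 * p * e / (e + 1) / 2 - s / 4 - p) / p) = 4 * c + 1 / p"
    unfolding pe c using s p by (simp add: field_simps)
  show "diff_matrix (eerk32 1 (1/2)) 2 1 (- x) = 4 * c + b"
    unfolding diff_matrix_expand coeff t21 by (simp add: p_inv)
  have t32: "- (1 / (4 / 3 * f) * (f / 3 - s / 4) / (s / 4)) = 3 / (4 * f) - 1 / s"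
    using s f by (simp add: field_simps)
  show "diff_matrix (eerk32 1 (1/2)) 3 2 (- x) = 3 / (4 * f) - 1 / (f + h) - x"
    unfolding diff_matrix_expand coeff t32 by (simp add: s_def)
  \<comment> \<open>\<open>A\<close> is the coefficient with indices 3 and 1; the one with indices 4
    and 1 is \<open>- A - 5 / 3 * f\<close>. Hence the two terms \<open>3 / (4 * f) * A / p\<close>
    cancel in the last entry.\<close>
  define A where "A = 2 * p * e / (e + 1) / 2 - s / 4 - p"
  have A: "A / (s * p) = - c - (x + b) / 4"
    unfolding A_def pe c p_inv[symmetric] using s p by (simp add: field_simps)
  have A41: "p - 5 / 3 * f - 2 * p * e / (e + 1) / 2 + s / 4 = - A - 5 / 3 * f"
    by (simp add: A_def)
  have "diff_matrix (eerk32 1 (1/2)) 3 1 (- x)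
    = - ((3 / (4 * f) - 1 / s) * A / p + 1 / (4 / 3 * f) * (- A - 5 / 3 * f) / p) + (- x)"
    unfolding diff_matrix_expand coeff t32 A41 A_def[symmetric] ..
  also have "\<dots> = A / (s * p) + 5 / 4 * (1 / p) - x"
    using s p f by (simp add: field_simps)
  also have "\<dots> = b - c"
    unfolding A p_inv by (simp add: field_simps)
  finally show "diff_matrix (eerk32 1 (1/2)) 3 1 (- x) = b - c" .
qed

section \<open>Nonnegativity of the quadratic form on one eigenvalue\<close>

lemma quadratic_form_2_nonneg:
  fixes A B d y z :: real
  assumes "0 \<le> A" and "0 < B" and "d\<^sup>2 \<le> 4 * A * B"
  shows "0 \<le> A * y\<^sup>2 + d * y * z + B * z\<^sup>2"
proof -
  \<comment> \<open>Completing the square in \<open>z\<close> after multiplication by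
    \<open>4 * B\<close>.\<close>
  have "0 \<le> (4 * A * B - d\<^sup>2) * y\<^sup>2 + (2 * B * z + d * y)\<^sup>2"
    using assms by simp
  also have "\<dots> = 4 * B * (A * y\<^sup>2 + d * y * z + B * z\<^sup>2)"
    by (simp add: power2_eq_square algebra_simps)
  finally show ?thesis
    using assms by (simp add: zero_le_mult_iff)
qed

text \<open>The cross terms with \<open>x1\<close> are absorbed using \<open>9/10 x1\<^sup>2 + 5/2 x2\<^sup>2 \<ge> 3 |x1 x2|\<close> and
  \<open>1/10 x1\<^sup>2 + 5/8 x3\<^sup>2 \<ge> 1/2 |x1 x3|\<close>.\<close>

lemma quadratic_form_3_nonneg:
  fixes d11 d22 d33 d21 d31 d32 x1 x2 x3 :: real
  assumes "1 \<le> d11" and "\<bar>d21\<bar> \<le> 3" and "\<bar>d31\<bar> \<le> 1 / 2" and "5 / 2 \<le> d22" and "5 / 8 < d33"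
    and "d32\<^sup>2 \<le> 4 * (d22 - 5 / 2) * (d33 - 5 / 8)"
  shows "0 \<le> d11 * x1\<^sup>2 + d22 * x2\<^sup>2 + d33 * x3\<^sup>2 + d21 * x2 * x1 + d31 * x3 * x1 + d32 * x3 * x2"
proof -
  \<comment> \<open>The weights just suffice: \<open>4 * (9 / 10) * (5 / 2) = 3\<^sup>2\<close>, and
    in the next fact \<open>4 * (1 / 10) * (5 / 8) = (1 / 2)\<^sup>2\<close>.\<close>
  have 1: "0 \<le> 9 / 10 * x1\<^sup>2 + d21 * x1 * x2 + 5 / 2 * x2\<^sup>2"
    by (rule quadratic_form_2_nonneg) (use abs_le_square_iff[of d21 3] assms in auto)
  have 2: "0 \<le> 1 / 10 * x1\<^sup>2 + d31 * x1 * x3 + 5 / 8 * x3\<^sup>2"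
    by (rule quadratic_form_2_nonneg)
      (use abs_le_square_iff[of d31 "1 / 2"] assms in \<open>auto simp: power2_eq_square\<close>)
  have 3: "0 \<le> (d22 - 5 / 2) * x2\<^sup>2 + d32 * x2 * x3 + (d33 - 5 / 8) * x3\<^sup>2"
    by (rule quadratic_form_2_nonneg) (use assms in auto)
  have "0 \<le> (d11 - 1) * x1\<^sup>2"
    using assms by simp
  with 1 2 3 show ?thesis
    by (simp add: algebra_simps)
qed

text \<open>From \<open>0 \<le> b \<le> 1\<close> and \<open>0 \<le> c \<le> 1 / 2\<close>
  everything follows except \<open>b - c \<le> 1 / 2\<close>, for which \<open>b\<close> and
  \<open>c\<close> are both compared with \<open>1 / (exp (x / 2) + 1)\<close>.\<close>

lemma eerk32_offdiag_bounds:
  fixes x :: real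
  assumes "0 < x"
  defines "f \<equiv> phi 2 (- x)" and "h \<equiv> phi 2 (- (x / 2))"
  defines "b \<equiv> x / (exp x - 1)" and "c \<equiv> 1 / ((exp (x / 2) + 1) * (f + h))"
  shows "\<bar>4 * c + b\<bar> \<le> 3" and "\<bar>b - c\<bar> \<le> 1 / 2"
proof -
  have f: "0 < f" "f \<le> 1 / 2" and h: "0 < h" "h \<le> 1 / 2"
    using phi_2_pos[of x] phi_2_pos[of "x / 2"] phi_2_le_half[of x] phi_2_le_half[of "x / 2"] assms(1)
    by (auto simp: f_def h_def)
  have "x \<le> exp x - 1"
    using exp_ge_add_one_self[of x] by linarith
  with assms(1) have b: "0 \<le> b" "b \<le> 1"
    by (auto simp: b_def divide_le_eq)
  have c0: "0 \<le> c"
    using f h by (simp add: c_def)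
  \<comment> \<open>One twelfth makes \<open>exp (x / 2)\<close> and the Jensen bounds
    \<open>exp (- (x / 3))\<close>, \<open>exp (- (x / 6))\<close> for \<open>2 * f\<close>,
    \<open>2 * h\<close> integer powers of \<open>a\<close>.\<close>
  define a where "a = exp (x / 12)"
  have a: "0 < a"
    by (simp add: a_def)
  have ea: "exp (x / 2) = a ^ 6"
    using exp_of_nat_mult[of 6 "x / 12"] by (simp add: a_def)
  have fa: "1 / a ^ 4 \<le> 2 * f"
    using phi_2_lower_exp[of x] assms(1) exp_of_nat_mult[of 4 "x / 12"]
    by (simp add: a_def f_def exp_minus inverse_eq_divide)
  have ha: "1 / a\<^sup>2 \<le> 2 * h"
    using phi_2_lower_exp[of "x / 2"] assms(1) exp_of_nat_mult[of 2 "x / 12"]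
    by (simp add: a_def h_def exp_minus inverse_eq_divide)
  \<comment> \<open>The arithmetic-geometric mean inequality in each factor.\<close>
  have "2 * a * (2 * a ^ 3) \<le> (1 + a\<^sup>2) * (1 + a ^ 6)"
  proof (rule mult_mono)
    show "2 * a \<le> 1 + a\<^sup>2"
      using zero_le_power2[of "a - 1"] by (simp add: power2_diff)
    show "2 * a ^ 3 \<le> 1 + a ^ 6"
      using zero_le_power2[of "a ^ 3 - 1"] by (simp add: power2_diff flip: power_mult)
  qed (use a in auto)
  then have "4 \<le> (1 + a\<^sup>2) * (1 + a ^ 6) / a ^ 4"
    using a by (simp add: le_divide_eq eval_nat_numeral)
  also have "\<dots> = (1 / a ^ 4 + 1 / a\<^sup>2) * (a ^ 6 + 1)"
    using a by (simp add: field_simps eval_nat_numeral)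
  also have "\<dots> \<le> (2 * f + 2 * h) * (a ^ 6 + 1)"
    using a fa ha by (intro mult_right_mono add_mono) auto
  finally have "2 \<le> (exp (x / 2) + 1) * (f + h)"
    by (simp add: ea algebra_simps)
  then have c1: "c \<le> 1 / 2"
    by (simp add: c_def divide_le_eq)
  define e where "e = exp (x / 2)"
  have e: "1 + x / 2 \<le> e"
    unfolding e_def by (rule exp_ge_add_one_self)
  \<comment> \<open>Uses \<open>f + h \<le> 1\<close>.\<close>
  have "1 / (e + 1) \<le> c"
    unfolding c_def e_def[symmetric] using f h e assms(1) by (intro divide_left_mono) auto
  moreover have "b \<le> 1 / 2 + 1 / (e + 1)"
  proof -
    have "exp x = e\<^sup>2"
      by (simp add: e_def exp_double[symmetric])
    then have "exp x - 1 = (e - 1) * (e + 1)"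
      by (simp add: power2_eq_square algebra_simps)
    then have "b = x / (e - 1) / (e + 1)"
      by (simp add: b_def)
    also have "x / (e - 1) \<le> 2"
      using e assms(1) by (simp add: divide_le_eq)
    then have "x / (e - 1) / (e + 1) \<le> 2 / (e + 1)"
      using e assms(1) by (intro divide_right_mono) auto
    also have "\<dots> = 1 / (e + 1) + 1 / (e + 1)"
      by simp
    also have "\<dots> \<le> 1 / 2 + 1 / (e + 1)"
      using e assms(1) by (intro add_right_mono) (simp add: divide_le_eq)
    finally show ?thesis .
  qed
  ultimately show "\<bar>b - c\<bar> \<le> 1 / 2"
    using b c1 by linarith
  show "\<bar>4 * c + b\<bar> \<le> 3"
    using b c0 c1 by linarith
qed

text \<open>The right-hand side is \<open>x / 2 * coth (x / 2)\<close>.\<close>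

lemma one_le_half_coth:
  fixes x :: real
  assumes "0 < x"
  shows "1 \<le> x / (1 - exp (- x)) - x / 2"
proof -
  have "exp (- x) < 1"
    using assms by simp
  moreover have "2 - x \<le> (2 + x) * exp (- x)"
    using two_minus_mult_exp_le[of x] assms by (simp add: exp_minus field_simps)
  ultimately show ?thesis
    by (simp add: field_simps)
qed

text \<open>Only rational bounds on \<open>f\<close> and \<open>h\<close> enter, so the discriminant
  condition becomes polynomial in \<open>x\<close>. Constant bounds serve for
  \<open>x \<le> 3\<close>, linear ones beyond.\<close>

lemma eerk32_form_condition:
  fixes x f h :: real
  assumes "0 < x" and f: "0 < f" "f \<le> h" "h \<le> 2 * f"
    and f_le: "(1 + x) * f \<le> 1" "(2 + 2 * x / 3) * f \<le> 1" and le_f: "1 \<le> (2 + x) * f"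
    and h_le: "(1 + x / 2) * h \<le> 1" "(2 + x / 3) * h \<le> 1"
  defines "d22 \<equiv> 4 / (f + h) - x / 2" and "d33 \<equiv> 3 / (4 * f) - x / 2"
    and "d32 \<equiv> 3 / (4 * f) - 1 / (f + h) - x"
  shows "5 / 2 \<le> d22" and "5 / 8 < d33" and "d32\<^sup>2 \<le> 4 * (d22 - 5 / 2) * (d33 - 5 / 8)"
proof -
  have h: "0 < h"
    using f by simp
  have r: "1 + x \<le> 1 / f" "2 + 2 * x / 3 \<le> 1 / f" "1 / f \<le> 2 + x"
    using f f_le le_f by (simp_all add: le_divide_eq divide_le_eq mult.commute)
  have "f + h \<le> 1 / (1 + x) + 1 / (1 + x / 2)"
    using f_le h_le \<open>0 < x\<close> by (intro add_mono) (simp_all add: le_divide_eq mult.commute)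
  also have "\<dots> \<le> 6 / (3 + 2 * x)"
    using \<open>0 < x\<close> by (simp add: divide_simps) (simp add: algebra_simps)
  finally have "4 / (6 / (3 + 2 * x)) \<le> 4 / (f + h)"
    using f h \<open>0 < x\<close> by (intro divide_left_mono) auto
  then have d22_large: "2 + 5 * x / 6 \<le> d22"
    using \<open>0 < x\<close> by (simp add: d22_def field_simps)
  have "f + h \<le> 1 / (2 + 2 * x / 3) + 1 / (2 + x / 3)"
    using f_le h_le \<open>0 < x\<close> by (intro add_mono) (simp_all add: le_divide_eq mult.commute)
  \<comment> \<open>Chosen so that \<open>4 / (f + h) \<ge> 4 + x / 2\<close>, whose linear term
    cancels the \<open>- x / 2\<close> in \<open>d22\<close>.\<close>
  also have "\<dots> \<le> 8 / (8 + x)"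
    using \<open>0 < x\<close> by (simp add: divide_simps) (simp add: algebra_simps)
  finally have "4 / (8 / (8 + x)) \<le> 4 / (f + h)"
    using f h \<open>0 < x\<close> by (intro divide_left_mono) auto
  then have d22_small: "4 \<le> d22"
    using \<open>0 < x\<close> by (simp add: d22_def field_simps)
  have d33_small: "3 / 2 \<le> d33" and d33_large: "3 / 4 + x / 4 \<le> d33"
    using r by (simp_all add: d33_def)
  \<comment> \<open>The ratio bounds \<open>f \<le> h \<le> 2 * f\<close> place \<open>f + h\<close>
    between \<open>2 * f\<close> and \<open>3 * f\<close>.\<close>
  have "1 / (3 * f) \<le> 1 / (f + h)" "1 / (f + h) \<le> 1 / (2 * f)"
    using f h by (auto intro!: divide_left_mono)
  then have d32: "1 / 4 * (1 / f) - x \<le> d32" "d32 \<le> 5 / 12 * (1 / f) - x"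
    by (simp_all add: d32_def)
  show "5 / 2 \<le> d22" "5 / 8 < d33"
    using d22_small d33_small by auto
  show "d32\<^sup>2 \<le> 4 * (d22 - 5 / 2) * (d33 - 5 / 8)"
  proof (cases "x \<le> 3")
    case True
    then have "\<bar>d32\<bar> \<le> 2"
      using d32 r \<open>0 < x\<close> by linarith
    then have "d32\<^sup>2 \<le> 2\<^sup>2"
      using abs_le_square_iff[of d32 2] by simp
    also have "\<dots> \<le> 4 * (4 - 5 / 2) * (3 / 2 - 5 / 8)"
      by simp
    also have "\<dots> \<le> 4 * (d22 - 5 / 2) * (d33 - 5 / 8)"
      using d22_small d33_small by (intro mult_mono) auto
    finally show ?thesis .
  next
    case False
    then have "\<bar>d32\<bar> \<le> 3 * x / 4"
      using d32 r by linarith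
    then have "d32\<^sup>2 \<le> (3 * x / 4)\<^sup>2"
      using abs_le_square_iff[of d32 "3 * x / 4"] \<open>0 < x\<close> by simp
    also have "\<dots> \<le> 4 * (5 * x / 6 - 1 / 2) * (x / 4 + 1 / 8)"
    proof -
      have "3 * 3 \<le> x * x"
        using False by (intro mult_mono) auto
      moreover have "3 * x \<le> x * x"
        using False by (intro mult_right_mono) auto
      moreover have "4 * (5 * x / 6 - 1 / 2) * (x / 4 + 1 / 8) = 5 / 6 * (x * x) - x / 12 - 1 / 4"
        by (simp add: algebra_simps)
      moreover have "(3 * x / 4)\<^sup>2 = 9 / 16 * (x * x)"
        by (simp add: power2_eq_square)
      ultimately show ?thesis
        using False by linarith
    qed
    also have "\<dots> \<le> 4 * (d22 - 5 / 2) * (d33 - 5 / 8)"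
      using d22_large d33_large False by (intro mult_mono) auto
    finally show ?thesis .
  qed
qed

lemma eerk32_diff_matrix_nonneg:
  fixes v :: "nat \<Rightarrow> real"
  assumes "z < 0"
  shows "0 \<le> (\<Sum>k=1..3. v k * (\<Sum>l=1..k. diff_matrix (eerk32 1 (1/2)) k l z * v l))"
proof -
  define x where "x = - z"
  then have x: "0 < x" and z: "z = - x"
    using assms by auto
  let ?f = "phi 2 (- x)" and ?h = "phi 2 (- (x / 2))"
  let ?d = "\<lambda>k l. diff_matrix (eerk32 1 (1/2)) k l z"
  have x2: "0 < x / 2"
    using x by simp
  have h_le: "(2 + x / 3) * ?h \<le> 1"
    using phi_2_upper_tangent[OF x2] by simp
  note cond = eerk32_form_condition[OF x phi_2_pos[OF x] phi_2_half_bounds[OF x] phi_2_upper_linear[OF x]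
      phi_2_upper_tangent[OF x] phi_2_lower_linear[OF x] phi_2_upper_linear[OF x2] h_le]
  have "0 \<le> ?d 1 1 * (v 1)\<^sup>2 + ?d 2 2 * (v 2)\<^sup>2 + ?d 3 3 * (v 3)\<^sup>2
      + ?d 2 1 * v 2 * v 1 + ?d 3 1 * v 3 * v 1 + ?d 3 2 * v 3 * v 2"
    unfolding z eerk32_diff_matrix[OF x]
    by (rule quadratic_form_3_nonneg[OF one_le_half_coth[OF x] eerk32_offdiag_bounds[OF x] cond])
  also have "\<dots> = (\<Sum>k=1..3. v k * (\<Sum>l=1..k. ?d k l * v l))"
    by (simp add: eval_nat_numeral algebra_simps)
  finally show ?thesis .
qed

section \<open>Energy estimate\<close>

lemma diag_mat_mult_nth: "(diag_mat d *v y) $ i = d i * y $ i"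
  by (simp add: matrix_vector_mult_def diag_mat_def if_distrib[where f = "\<lambda>c. c * _"] cong: if_cong)

text \<open>The same \<open>Q\<close> serves every \<open>f\<close>, so a vector identity involving
  several matrix functions splits into one scalar identity per eigenvalue.\<close>

lemma sym_matfun_mult_eigenbasis:
  fixes A Q :: "real ^ 'n ^ 'n"
  assumes Q: "orthogonal_matrix Q" and A: "A = Q ** diag_mat d ** transpose Q"
  shows "(transpose Q *v (sym_matfun f A *v x)) $ i = f (d i) * (transpose Q *v x) $ i"
proof -
  have "transpose Q *v (sym_matfun f A *v x)
      = (transpose Q ** Q) *v (diag_mat (\<lambda>i. f (d i)) *v (transpose Q *v x))"
    unfolding sym_matfun_eqI[OF Q A]
    by (simp add: matrix_vector_mul_assoc matrix_mul_assoc del: transpose_matrix_vector)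
  also have "\<dots> = diag_mat (\<lambda>i. f (d i)) *v (transpose Q *v x)"
    using Q by (simp add: orthogonal_matrix)
  also have "\<dots> $ i = f (d i) * (transpose Q *v x) $ i"
    by (rule diag_mat_mult_nth)
  finally show ?thesis .
qed

lemma mult_eigenbasis:
  fixes A Q :: "real ^ 'n ^ 'n"
  assumes Q: "orthogonal_matrix Q" and A: "A = Q ** diag_mat d ** transpose Q"
  shows "(transpose Q *v (A *v x)) $ i = d i * (transpose Q *v x) $ i"
proof -
  have "sym_matfun (\<lambda>z. z) A = A"
    unfolding sym_matfun_eqI[OF Q A] by (rule A[symmetric])
  then show ?thesis
    using sym_matfun_mult_eigenbasis[OF Q A, of "\<lambda>z. z"] by simp
qed

lemma inner_orthogonal_matrix:
  fixes Q :: "real ^ 'n ^ 'n"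
  assumes "orthogonal_matrix Q"
  shows "(transpose Q *v x) \<bullet> (transpose Q *v y) = x \<bullet> y"
proof -
  have "(transpose Q *v x) \<bullet> (transpose Q *v y) = x \<bullet> ((Q ** transpose Q) *v y)"
    by (simp add: dot_lmul_matrix matrix_vector_mul_assoc[symmetric])
  then show ?thesis
    using assms by (simp add: orthogonal_matrix_def)
qed

text \<open>Column \<open>i\<close> of \<open>Q\<close> is the witness. This turns definiteness of
  the form into a sign for \<open>d i\<close>.\<close>

lemma eigenvalue_of_quadratic_form:
  fixes A Q :: "real ^ 'n ^ 'n"
  assumes Q: "orthogonal_matrix Q" and A: "A = Q ** diag_mat d ** transpose Q"
  obtains v where "v \<noteq> 0" and "v \<bullet> (A *v v) = d i * (v \<bullet> v)"
proof
  let ?v = "Q *v axis i 1"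
  have QQ: "transpose Q ** Q = mat 1"
    using Q by (simp add: orthogonal_matrix)
  have e: "transpose Q *v ?v = axis i 1"
    by (simp add: matrix_vector_mul_assoc QQ)
  show "?v \<noteq> 0"
    using e by (metis axis_eq_0_iff matrix_vector_mult_0_right zero_neq_one)
  have "A *v ?v = Q *v (diag_mat d *v axis i 1)"
    unfolding A by (simp add: matrix_vector_mul_assoc[symmetric] e del: matrix_vector_mult_basis transpose_matrix_vector)
  also have "diag_mat d *v axis i 1 = d i *\<^sub>R axis i 1"
    by (simp add: vec_eq_iff diag_mat_mult_nth axis_def del: matrix_vector_mult_basis)
  finally show "?v \<bullet> (A *v ?v) = d i * (?v \<bullet> ?v)"
    by (simp add: matrix_vector_mult_scaleR del: matrix_vector_mult_basis)
qed

section \<open>Inversion of the triangular scheme\<close>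

text \<open>Below the diagonal this is the recursion of \<open>dis_theta\<close> cleared of its
  denominator: \<open>dis_theta\<close> is the inverse of the triangular array of
  \<open>diff_coeff\<close>.\<close>

lemma dis_theta_inverse:
  assumes "j \<le> k" and "diff_coeff a (j + 1) j z \<noteq> 0"
  shows "(\<Sum>l=j..k. dis_theta a k l z * diff_coeff a (l + 1) j z) = (if j = k then 1 else 0)"
proof (cases "j = k")
  case True
  then show ?thesis
    using assms by (simp add: dis_theta.simps)
next
  case False
  then have "dis_theta a k j z * diff_coeff a (j + 1) j z
      = - (\<Sum>l=j+1..k. dis_theta a k l z * diff_coeff a (l + 1) j z)"
    using assms by (subst dis_theta.simps) (simp add: sum_divide_distrib[symmetric])
  then show ?thesis
    using assms False by (simp add: sum.atLeast_Suc_atMost)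
qed

lemma sum_atLeastAtMost_triangle_swap:
  fixes f :: "nat \<Rightarrow> nat \<Rightarrow> 'a::comm_monoid_add"
  shows "(\<Sum>l=m..k. \<Sum>j=m..l. f l j) = (\<Sum>j=m..k. \<Sum>l=j..k. f l j)"
proof -
  have "(\<Sum>l=m..k. \<Sum>j=m..l. f l j) = (\<Sum>l=m..k. \<Sum>j | j \<in> {m..k} \<and> j \<le> l. f l j)"
    by (intro sum.cong refl) auto
  also have "\<dots> = (\<Sum>j=m..k. \<Sum>l | l \<in> {m..k} \<and> j \<le> l. f l j)"
    by (rule sum.swap_restrict) auto
  also have "\<dots> = (\<Sum>j=m..k. \<Sum>l=j..k. f l j)"
    by (intro sum.cong refl) auto
  finally show ?thesis .
qed

text \<open>Two consecutive stage equations are subtracted. The earlier one has no term with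
  \<open>j = l\<close>, hence the separate case in \<open>diff_coeff\<close>.\<close>

lemma stage_increment:
  fixes V w :: "nat \<Rightarrow> real"
  assumes V: "\<And>i. i \<in> {1..s} \<Longrightarrow> V (i + 1) = V 1 + (\<Sum>j=1..i. a (i + 1) j z * w j)"
    and l: "l \<in> {1..s}"
  shows "V (l + 1) - V l = (\<Sum>j=1..l. diff_coeff a (l + 1) j z * w j)"
proof (cases "l = 1")
  case True
  then show ?thesis
    using V[of 1] l by (simp add: diff_coeff_def)
next
  case False
  with l obtain i where i: "l = i + 1" "i \<in> {1..s}"
    by (cases l) auto
  have "V (l + 1) - V l = (\<Sum>j=1..i. a (l + 1) j z * w j) + a (l + 1) l z * w l - (\<Sum>j=1..i. a l j z * w j)"
    using V[OF l] V[OF i(2)] i(1) by simp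
  also have "\<dots> = (\<Sum>j=1..i. diff_coeff a (l + 1) j z * w j) + diff_coeff a (l + 1) l z * w l"
    using i by (simp add: diff_coeff_def sum_subtractf left_diff_distrib)
  finally show ?thesis
    using i by simp
qed

text \<open>The \<open>\<theta>\<close> part of the differentiation matrix recovers the stage residuals \<open>w\<close>; the part \<open>z/2 (2 - \<delta>)\<close>
  telescopes to the averaged stages.\<close>

lemma diff_matrix_stage_increments:
  fixes V w :: "nat \<Rightarrow> real"
  assumes V: "\<And>i. i \<in> {1..s} \<Longrightarrow> V (i + 1) = V 1 + (\<Sum>j=1..i. a (i + 1) j z * w j)"
    and nz: "\<And>i. i \<in> {1..s} \<Longrightarrow> diff_coeff a (i + 1) i z \<noteq> 0"
    and k: "k \<in> {1..s}"
  shows "(\<Sum>l=1..k. diff_matrix a k l z * (V (l + 1) - V l)) = w k + z / 2 * (V (k + 1) + V k) - z * V 1"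
proof -
  have "(\<Sum>l=1..k. dis_theta a k l z * (V (l + 1) - V l))
      = (\<Sum>l=1..k. \<Sum>j=1..l. dis_theta a k l z * diff_coeff a (l + 1) j z * w j)"
  proof (intro sum.cong refl)
    fix l
    assume "l \<in> {1..k}"
    then have "l \<in> {1..s}"
      using k by auto
    with V have "V (l + 1) - V l = (\<Sum>j=1..l. diff_coeff a (l + 1) j z * w j)"
      by (rule stage_increment)
    then show "dis_theta a k l z * (V (l + 1) - V l) = (\<Sum>j=1..l. dis_theta a k l z * diff_coeff a (l + 1) j z * w j)"
      by (simp only: sum_distrib_left mult.assoc)
  qed
  also have "\<dots> = (\<Sum>j=1..k. (\<Sum>l=j..k. dis_theta a k l z * diff_coeff a (l + 1) j z) * w j)"
    by (simp add: sum_atLeastAtMost_triangle_swap sum_distrib_right)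
  also have "\<dots> = (\<Sum>j=1..k. if j = k then w k else 0)"
    using k by (intro sum.cong refl) (subst dis_theta_inverse; use nz in auto)
  finally have th: "(\<Sum>l=1..k. dis_theta a k l z * (V (l + 1) - V l)) = w k"
    using k by simp
  have "(\<Sum>l=1..k. V (l + 1) - V l) = V (k + 1) - V 1"
    using sum_Suc_diff[of 1 k V] k by simp
  then have tel_z: "(\<Sum>l=1..k. z * (V (l + 1) - V l)) = z * (V (k + 1) - V 1)"
    by (simp only: sum_distrib_left[symmetric])
  \<comment> \<open>The weight is \<open>z\<close> on every increment minus \<open>z / 2\<close> on
    the last, so the sum telescopes up to half of the last increment.\<close>
  have "(\<Sum>l=1..k. diff_matrix a k l z * (V (l + 1) - V l))
      = (\<Sum>l=1..k. dis_theta a k l z * (V (l + 1) - V l) + z * (V (l + 1) - V l)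
          - (if l = k then z / 2 * (V (k + 1) - V k) else 0))"
    by (intro sum.cong refl) (auto simp: diff_matrix_def algebra_simps)
  also have "\<dots> = w k + z * (V (k + 1) - V 1) - z / 2 * (V (k + 1) - V k)"
    using k by (subst sum_subtractf, subst sum.distrib) (simp add: th tel_z del: One_nat_def)
  finally show ?thesis
    by (simp add: field_simps)
qed

section \<open>Energy change over one stage\<close>

text \<open>The descent lemma: along the segment from \<open>x\<close> to \<open>y\<close>, the
  excess \<open>\<psi>\<close> of \<open>F\<close> over its quadratic model has nonpositive
  derivative.\<close>

lemma lipschitz_gradient_upper_bound:
  fixes F :: "'a::real_inner \<Rightarrow> real" and f :: "'a \<Rightarrow> 'a"
  assumes F: "\<And>v. GDERIV F v :> f v" and f: "l-lipschitz_on UNIV f"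
  shows "F y \<le> F x + f x \<bullet> (y - x) + l / 2 * (norm (y - x))\<^sup>2"
proof -
  define p where "p = y - x"
  define \<psi> where "\<psi> t = F (x + t *\<^sub>R p) - t * (f x \<bullet> p) - l / 2 * t\<^sup>2 * (norm p)\<^sup>2" for t
  have D: "(\<psi> has_real_derivative (f (x + t *\<^sub>R p) - f x) \<bullet> p - l * t * (norm p)\<^sup>2) (at t)" for t
  proof -
    have "((\<lambda>t. x + t *\<^sub>R p) has_derivative (\<lambda>h. h *\<^sub>R p)) (at t)"
      by (auto intro!: derivative_eq_intros)
    from has_derivative_compose[OF this F[unfolded gderiv_def]]
    have "((\<lambda>t. F (x + t *\<^sub>R p)) has_derivative (\<lambda>h. (h *\<^sub>R p) \<bullet> f (x + t *\<^sub>R p))) (at t)" .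
    also have "(\<lambda>h. (h *\<^sub>R p) \<bullet> f (x + t *\<^sub>R p)) = (*) (f (x + t *\<^sub>R p) \<bullet> p)"
      by (simp add: fun_eq_iff inner_commute[of p] mult.commute)
    finally have "((\<lambda>t. F (x + t *\<^sub>R p)) has_real_derivative f (x + t *\<^sub>R p) \<bullet> p) (at t)"
      by (simp add: has_field_derivative_def)
    then show ?thesis
      unfolding \<psi>_def by (auto intro!: derivative_eq_intros simp: inner_diff_left)
  qed
  have "\<psi> 1 \<le> \<psi> 0"
  proof (rule DERIV_nonpos_imp_nonincreasing[of 0 1 \<psi>])
    fix t :: real
    assume t: "0 \<le> t" "t \<le> 1"
    have "(f (x + t *\<^sub>R p) - f x) \<bullet> p \<le> norm (f (x + t *\<^sub>R p) - f x) * norm p"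
      by (rule norm_cauchy_schwarz)
    also have "\<dots> \<le> (l * norm (t *\<^sub>R p)) * norm p"
      using lipschitz_onD[OF f, of "x + t *\<^sub>R p" x] by (intro mult_right_mono) (auto simp: dist_norm)
    also have "\<dots> = l * t * (norm p)\<^sup>2"
      using t by (simp add: power2_eq_square)
    finally show "\<exists>d. (\<psi> has_real_derivative d) (at t) \<and> d \<le> 0"
      using D[of t] by (intro exI conjI) auto
  qed simp
  then show ?thesis
    by (simp add: \<psi>_def p_def)
qed

lemma transpose_stab_op: "transpose L = L \<Longrightarrow> transpose (stab_op \<kappa> L) = stab_op \<kappa> L"
  by (simp add: stab_op_def transpose_def vec_eq_iff mat_def)

lemma stab_op_mult: "stab_op \<kappa> L *v x = L *v x + \<kappa> *\<^sub>R x"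
  by (simp add: stab_op_def matrix_vector_mult_add_rdistrib scaleR_matrix_vector_assoc[symmetric])

text \<open>By symmetry the quadratic energy changes by exactly
  \<open>1 / 2 * ((y - x) \<bullet> (L *v (x + y)))\<close>. The stabilization terms add up to
  \<open>\<kappa> / 2\<close> times the squared increment, which absorbs the descent remainder
  because \<open>lg \<le> \<kappa>\<close>.\<close>

lemma energy_step:
  fixes L :: "real ^ 'm ^ 'm"
  assumes sym: "transpose L = L" and G: "\<And>v. GDERIV (\<lambda>w. G w \<bullet> (\<chi> i. 1)) v :> - g v"
    and g: "lg-lipschitz_on UNIV g" and \<kappa>: "lg \<le> \<kappa>"
  shows "energy L G y - energy L G x
    \<le> - ((y - x) \<bullet> (stab_nonlin \<kappa> g x - (1 / 2) *\<^sub>R (stab_op \<kappa> L *v (x + y))))"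
proof -
  have "lg-lipschitz_on UNIV (\<lambda>v. - g v)"
    using g by (simp add: lipschitz_on_def dist_norm norm_minus_commute)
  from lipschitz_gradient_upper_bound[OF G this, of y x]
  have "G y \<bullet> (\<chi> i. 1) \<le> G x \<bullet> (\<chi> i. 1) - g x \<bullet> (y - x) + lg / 2 * (norm (y - x))\<^sup>2"
    by simp
  also have "\<dots> \<le> G x \<bullet> (\<chi> i. 1) - g x \<bullet> (y - x) + \<kappa> / 2 * (norm (y - x))\<^sup>2"
    using \<kappa> by (simp add: mult_right_mono)
  finally have "G y \<bullet> (\<chi> i. 1) - G x \<bullet> (\<chi> i. 1) \<le> - (g x \<bullet> (y - x)) + \<kappa> / 2 * (norm (y - x))\<^sup>2"
    by simp
  moreover have "x \<bullet> (L *v y) = y \<bullet> (L *v x)"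
    using symmetric_inner[OF sym, of x y] by (simp add: inner_commute)
  ultimately show ?thesis
    by (simp add: energy_def stab_nonlin_def stab_op_mult power2_norm_eq_inner matrix_vector_right_distrib
        inner_simps inner_commute algebra_simps)
qed

section \<open>Energy dissipation\<close>

text \<open>Places the spectrum on the negative axis, where the coefficient functions are
  controlled.\<close>

lemma negative_multiple_diagonalization:
  fixes B :: "real ^ 'n ^ 'n"
  assumes \<tau>: "\<tau> > 0" and sym: "transpose B = B" and pos: "\<And>v. v \<noteq> 0 \<Longrightarrow> v \<bullet> (B *v v) > 0"
  obtains Q d where "orthogonal_matrix Q" "- \<tau> *\<^sub>R B = Q ** diag_mat d ** transpose Q" "\<And>i. d i < 0"
proof -
  have "transpose (- \<tau> *\<^sub>R B) = - \<tau> *\<^sub>R B"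
    using sym by (simp add: transpose_def vec_eq_iff)
  then obtain Q d where Q: "orthogonal_matrix Q" and A: "- \<tau> *\<^sub>R B = Q ** diag_mat d ** transpose Q"
    using symmetric_matrix_diagonalizable by blast
  have "d i < 0" for i
  proof -
    obtain v where "v \<noteq> 0" and v: "v \<bullet> ((- \<tau> *\<^sub>R B) *v v) = d i * (v \<bullet> v)"
      using eigenvalue_of_quadratic_form[OF Q A] by blast
    have "v \<bullet> ((- \<tau> *\<^sub>R B) *v v) < 0"
      unfolding scaleR_matrix_vector_assoc[symmetric] using pos[OF \<open>v \<noteq> 0\<close>] \<tau> by simp
    with v show ?thesis
      by (metis inner_ge_zero mult_less_0_iff not_less)
  qed
  with Q A show ?thesis
    by (rule that)
qed

lemma energy_le_dissipation:
  fixes L :: "real ^ 'm ^ 'm"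
  assumes \<tau>: "\<tau> > 0" and sym: "transpose L = L"
    and pos: "\<And>v. v \<noteq> 0 \<Longrightarrow> v \<bullet> (stab_op \<kappa> L *v v) > 0"
    and G: "\<And>v. GDERIV (\<lambda>w. G w \<bullet> (\<chi> i. 1)) v :> - g v"
    and g: "lg-lipschitz_on UNIV g" and \<kappa>: "lg \<le> \<kappa>"
    and V: "\<And>i. i \<in> {1..s} \<Longrightarrow> V (i + 1) = V 1 +
      (\<Sum>j=1..i. sym_matfun (a (i + 1) j) (- \<tau> *\<^sub>R stab_op \<kappa> L)
        *v (\<tau> *\<^sub>R stab_nonlin \<kappa> g (V j) - \<tau> *\<^sub>R (stab_op \<kappa> L *v V 1)))"
    and nz: "\<And>z i. z < 0 \<Longrightarrow> i \<in> {1..s} \<Longrightarrow> diff_coeff a (i + 1) i z \<noteq> 0"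
    and j: "j \<le> s"
  shows "energy L G (V (j + 1)) - energy L G (V 1) \<le> dissipation (diff_matrix a) \<tau> (stab_op \<kappa> L) V j"
proof -
  let ?B = "stab_op \<kappa> L" and ?A = "- \<tau> *\<^sub>R stab_op \<kappa> L"
  obtain Q d where Q: "orthogonal_matrix Q" and A: "?A = Q ** diag_mat d ** transpose Q"
    and d_neg: "\<And>i. d i < 0"
    using negative_multiple_diagonalization[OF \<tau> transpose_stab_op[OF sym] pos] by blast
  \<comment> \<open>\<open>hat x i\<close> is coordinate \<open>i\<close> of \<open>x\<close> in the
    eigenbasis; there each matrix function acts as the number \<open>f (d i)\<close>.\<close>
  define hat where "hat x i = (transpose Q *v x) $ i" for x i
  have hat_add: "hat (x + y) i = hat x i + hat y i"
    and hat_diff: "hat (x - y) i = hat x i - hat y i"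
    and hat_scale: "hat (c *\<^sub>R x) i = c * hat x i"
    and hat_sum: "hat (\<Sum>k\<in>S. h k) i = (\<Sum>k\<in>S. hat (h k) i)" for x y c i h and S :: "nat set"
    by (simp_all add: hat_def matrix_vector_right_distrib matrix_vector_mult_diff_distrib
        matrix_vector_mult_scaleR linear_sum[OF matrix_vector_mul_linear] del: transpose_matrix_vector)
  have hat_f: "hat (sym_matfun f ?A *v x) i = f (d i) * hat x i" for f x i
    unfolding hat_def by (rule sym_matfun_mult_eigenbasis[OF Q A])
  have hat_A: "- \<tau> * hat (?B *v x) i = d i * hat x i" for x i
    using mult_eigenbasis[OF Q A, of x i] unfolding scaleR_matrix_vector_assoc[symmetric] hat_def[symmetric] hat_scale .
  have hat_eqI: "x = y" if "\<And>i. hat x i = hat y i" for x y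
  proof -
    have "transpose Q *v x = transpose Q *v y"
      using that by (simp add: hat_def vec_eq_iff del: transpose_matrix_vector)
    then have "(Q ** transpose Q) *v x = (Q ** transpose Q) *v y"
      by (simp only: matrix_vector_mul_assoc[symmetric])
    then show ?thesis
      using Q by (simp add: orthogonal_matrix_def)
  qed
  have row: "(\<Sum>l=1..k. sym_matfun (diff_matrix a k l) ?A *v stage_diff V l)
      = \<tau> *\<^sub>R (stab_nonlin \<kappa> g (V k) - (1 / 2) *\<^sub>R (?B *v (V k + V (k + 1))))" if k: "k \<in> {1..s}" for k
  proof (rule hat_eqI)
    fix i
    define w where "w j = hat (\<tau> *\<^sub>R stab_nonlin \<kappa> g (V j) - \<tau> *\<^sub>R (?B *v V 1)) i" for j
    have "hat (\<Sum>l=1..k. sym_matfun (diff_matrix a k l) ?A *v stage_diff V l) i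
        = (\<Sum>l=1..k. diff_matrix a k l (d i) * (hat (V (l + 1)) i - hat (V l) i))"
      by (simp only: hat_sum hat_f stage_diff_def hat_diff)
    also have "\<dots> = w k + d i / 2 * (hat (V (k + 1)) i + hat (V k) i) - d i * hat (V 1) i"
    proof (rule diff_matrix_stage_increments[where s = s and V = "\<lambda>k. hat (V k) i"])
      fix i' :: nat
      assume i': "i' \<in> {1..s}"
      show "hat (V (i' + 1)) i = hat (V 1) i + (\<Sum>j=1..i'. a (i' + 1) j (d i) * w j)"
        by (subst V[OF i']) (simp only: hat_add hat_sum hat_f w_def)
      show "diff_coeff a (i' + 1) i' (d i) \<noteq> 0"
        using nz d_neg i' by blast
    qed (rule k)
    \<comment> \<open>By \<open>hat_A\<close> the two terms in \<open>V 1\<close> cancel, one of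
      them hidden in \<open>w k\<close>.\<close>
    also have "\<dots> = hat (\<tau> *\<^sub>R (stab_nonlin \<kappa> g (V k) - (1 / 2) *\<^sub>R (?B *v (V k + V (k + 1))))) i"
      using hat_A[of "V 1" i] hat_A[of "V k" i] hat_A[of "V (k + 1)" i]
      by (simp add: w_def hat_diff hat_scale hat_add matrix_vector_right_distrib algebra_simps add_divide_distrib)
    finally show "hat (\<Sum>l=1..k. sym_matfun (diff_matrix a k l) ?A *v stage_diff V l) i
        = hat (\<tau> *\<^sub>R (stab_nonlin \<kappa> g (V k) - (1 / 2) *\<^sub>R (?B *v (V k + V (k + 1))))) i" .
  qed
  have "energy L G (V (k + 1)) - energy L G (V k) \<le> - (1 / \<tau>) *
      (stage_diff V k \<bullet> (\<Sum>l=1..k. sym_matfun (diff_matrix a k l) ?A *v stage_diff V l))" if "k \<in> {1..j}" for k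
    using energy_step[OF sym G g \<kappa>, of "V (k + 1)" "V k"] row[of k] that j \<tau>
    by (simp add: stage_diff_def)
  then have "(\<Sum>k=1..j. energy L G (V (k + 1)) - energy L G (V k)) \<le> (\<Sum>k=1..j. - (1 / \<tau>) *
      (stage_diff V k \<bullet> (\<Sum>l=1..k. sym_matfun (diff_matrix a k l) ?A *v stage_diff V l)))"
    by (rule sum_mono)
  also have "(\<Sum>k=1..j. energy L G (V (k + 1)) - energy L G (V k)) = energy L G (V (j + 1)) - energy L G (V 1)"
    using sum_Suc_diff[of 1 j "\<lambda>k. energy L G (V k)"] by simp
  finally show ?thesis
    by (simp only: dissipation_def sum_distrib_left)
qed

text \<open>Orthogonal coordinates preserve the inner product, so the double sum is a sum over the
  eigenvalues of scalar forms, each nonnegative by \<open>D\<close>.\<close>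

lemma dissipation_nonpos:
  fixes B :: "real ^ 'm ^ 'm"
  assumes \<tau>: "\<tau> > 0" and sym: "transpose B = B" and pos: "\<And>v. v \<noteq> 0 \<Longrightarrow> v \<bullet> (B *v v) > 0"
    and D: "\<And>z v. z < 0 \<Longrightarrow> 0 \<le> (\<Sum>k=1..s. v k * (\<Sum>l=1..k. D k l z * v l))"
    and j: "j \<le> s"
  shows "dissipation D \<tau> B V j \<le> 0"
proof -
  let ?A = "- \<tau> *\<^sub>R B"
  obtain Q d where Q: "orthogonal_matrix Q" and A: "?A = Q ** diag_mat d ** transpose Q"
    and d_neg: "\<And>i. d i < 0"
    using negative_multiple_diagonalization[OF \<tau> sym pos] by blast
  define y where "y k i = (transpose Q *v stage_diff V k) $ i" for k i
  have "0 \<le> (\<Sum>k=1..j. y k i * (\<Sum>l=1..k. D k l (d i) * y l i))" for i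
  proof -
    \<comment> \<open>Padding with zeros reduces the form truncated at \<open>j\<close> to the full
      form of size \<open>s\<close>.\<close>
    define v where "v k = (if k \<le> j then y k i else 0)" for k
    have "(\<Sum>k=1..j. y k i * (\<Sum>l=1..k. D k l (d i) * y l i)) = (\<Sum>k=1..j. v k * (\<Sum>l=1..k. D k l (d i) * v l))"
      by (intro sum.cong refl arg_cong2[of _ _ _ _ "(*)"]) (auto simp: v_def)
    also have "\<dots> = (\<Sum>k=1..s. v k * (\<Sum>l=1..k. D k l (d i) * v l))"
      by (rule sum.mono_neutral_left) (use j in \<open>auto simp: v_def\<close>)
    finally show ?thesis
      using D[OF d_neg] by simp
  qed
  then have "0 \<le> (\<Sum>i\<in>UNIV. \<Sum>k=1..j. y k i * (\<Sum>l=1..k. D k l (d i) * y l i))"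
    by (rule sum_nonneg)
  also have "\<dots> = (\<Sum>k=1..j. \<Sum>i\<in>UNIV. y k i * (\<Sum>l=1..k. D k l (d i) * y l i))"
    by (rule sum.swap)
  also have "\<dots> = (\<Sum>k=1..j. stage_diff V k \<bullet> (\<Sum>l=1..k. sym_matfun (D k l) ?A *v stage_diff V l))"
  proof (intro sum.cong refl)
    fix k
    have "stage_diff V k \<bullet> (\<Sum>l=1..k. sym_matfun (D k l) ?A *v stage_diff V l)
        = (transpose Q *v stage_diff V k)
          \<bullet> (\<Sum>l=1..k. transpose Q *v (sym_matfun (D k l) ?A *v stage_diff V l))"
      by (simp only: inner_orthogonal_matrix[OF Q] linear_sum[OF matrix_vector_mul_linear, symmetric])
    also have "\<dots> = (\<Sum>i\<in>UNIV. y k i * (\<Sum>l=1..k. D k l (d i) * y l i))"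
      by (simp only: inner_vec_def sum_component sym_matfun_mult_eigenbasis[OF Q A] y_def inner_real_def)
    finally show "(\<Sum>i\<in>UNIV. y k i * (\<Sum>l=1..k. D k l (d i) * y l i))
        = stage_diff V k \<bullet> (\<Sum>l=1..k. sym_matfun (D k l) ?A *v stage_diff V l)" ..
  qed
  finally show ?thesis
    using \<tau> by (simp add: dissipation_def divide_nonneg_pos)
qed

theorem corollary4p2:
  fixes L :: "real ^ 'm ^ 'm"
    and G g :: "real ^ 'm \<Rightarrow> real ^ 'm"
    and \<tau> \<kappa> lg :: real
    and u :: "nat \<Rightarrow> real ^ 'm"
    and U :: "nat \<Rightarrow> nat \<Rightarrow> real ^ 'm"
    and n j :: nat
  assumes "\<tau> > 0"
    and "transpose L = L"
    and "\<And>v. v \<noteq> 0 \<Longrightarrow> v \<bullet> (L *v v) > 0"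
    and "\<And>v i. G v $ i \<ge> 0"
    and "\<And>v. GDERIV (\<lambda>w. G w \<bullet> (\<chi> i. 1)) v :> - g v"
    and "lg > 0"
    and "lg-lipschitz_on UNIV g"
    and "\<kappa> \<ge> 2 * lg"
    and "eerk_solution 3 (eerk32 1 (1 / 2)) \<tau> \<kappa> L g u U"
    and "n \<ge> 1"
    and "1 \<le> j" and "j \<le> 3"
  shows "energy L G (U n (j + 1)) - energy L G (U n 1)
           \<le> dissipation (diff_matrix (eerk32 1 (1 / 2))) \<tau> (stab_op \<kappa> L) (U n) j
       \<and> dissipation (diff_matrix (eerk32 1 (1 / 2))) \<tau> (stab_op \<kappa> L) (U n) j \<le> 0"
proof
  \<comment> \<open>The shift by \<open>\<kappa> \<ge> 0\<close> keeps the operator positive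
    definite.\<close>
  have pos: "v \<bullet> (stab_op \<kappa> L *v v) > 0" if "v \<noteq> 0" for v
    using assms(3)[OF that] assms(6,8) by (simp add: stab_op_mult inner_add_right add_pos_nonneg)
  have stages: "U n (i + 1) = U n 1 +
      (\<Sum>j=1..i. sym_matfun (eerk32 1 (1 / 2) (i + 1) j) (- \<tau> *\<^sub>R stab_op \<kappa> L)
        *v (\<tau> *\<^sub>R stab_nonlin \<kappa> g (U n j) - \<tau> *\<^sub>R (stab_op \<kappa> L *v U n 1)))" if "i \<in> {1..3}" for i
    using assms(9,10) that unfolding eerk_solution_def by blast
  show "energy L G (U n (j + 1)) - energy L G (U n 1)
      \<le> dissipation (diff_matrix (eerk32 1 (1 / 2))) \<tau> (stab_op \<kappa> L) (U n) j"
  proof (rule energy_le_dissipation[OF assms(1,2) pos assms(5,7) _ stages _ assms(12)])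
    show "lg \<le> \<kappa>"
      using assms(6,8) by simp
    show "diff_coeff (eerk32 1 (1 / 2)) (i + 1) i z \<noteq> 0" if "z < 0" "i \<in> {1..3}" for z i
      using eerk32_diff_coeff_pos[OF that] by simp
  qed
  show "dissipation (diff_matrix (eerk32 1 (1 / 2))) \<tau> (stab_op \<kappa> L) (U n) j \<le> 0"
    by (rule dissipation_nonpos[OF assms(1) transpose_stab_op[OF assms(2)] pos
        eerk32_diff_matrix_nonneg assms(12)])
qed

end
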